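(* Let $a,b\in\mathbb{C}$ be fixed and, for each integer $n\ge1$, let $\mathbf{T}_n=\mathrm{tridiag}(a,b,a)\in\mathbb{C}^{n\times n}$ and $\mathbf{Er}(\mathbf{T}_n)=\exp(\mathbf{T}_n)-\Psi(\mathbf{T}_n)$. Then, for large $n$, $$\|\mathbf{Er}(\mathbf{T}_n)\|_{\infty}\lesssim 2e^{\operatorname{Re}(b)}\left(\frac{|a|e}{n+1}\right)^{n+1},$$ that is, there is a sequence $\varepsilon_n\to 0$ (as $n\to\infty$) such that $\|\mathbf{Er}(\mathbf{T}_n)\|_{\infty}\le (1+\varepsilon_n)\,2e^{\operatorname{Re}(b)}\left(\frac{|a|e}{n+1}\right)^{n+1}$ for all sufficiently large $n$.
   Context: $\mathrm{tridiag}(a,b,a)$ denotes the $n\times n$ tridiagonal Toeplitz matrix with all main diagonal entries equal to $b$, all sub-diagonal and super-diagonal entries equal to $a$, and all other entries zero. $\exp$ is the matrix exponential, $\|\cdot\|_\infty$ is the maximum absolute row sum of a matrix, and the number $e$ is Euler's number. For an integer $k\ge 0$ and $x\in\mathbb{C}$, $I_k(x)=\sum_{s=0}^{\infty}\frac{1}{s!(k+s)!}\left(\frac{x}{2}\right)^{k+2s}$ is the modified Bessel function of the first kind. For a vector $\mathbf{u}$ of length $n$, $\mathrm{Toeplitz}\{\mathbf{u}\}$ is the $n\times n$ Toeplitz matrix whose first column and first row are both $\mathbf{u}$. For a vector $\mathbf{v}=(v_1,\dots,v_n)$, $\mathrm{Hankel}\{\mathbf{v}\}$ is the $n\times n$ Hankel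 matrix whose first column is $\mathbf{v}$ and whose last row is the reversal of $\mathbf{v}$; that is, its $(i,j)$ entry is $v_{i+j-1}$ if $i+j\le n+1$ and $v_{2n+1-i-j}$ otherwise. For $\mathbf{T}_n=\mathrm{tridiag}(a,b,a)$, define $\Psi(\mathbf{T}_n)=\mathrm{Toeplitz}\{\mathbf{u}_n\}-\mathrm{Hankel}\{\mathbf{v}_n\}$, where $\mathbf{u}_n=(e^bI_0(2a),e^bI_1(2a),\dots,e^bI_{n-1}(2a))$ and $\mathbf{v}_n=(e^bI_2(2a),e^bI_3(2a),\dots,e^bI_{n+1}(2a))$. *)

theory Defs
  imports "HOL-Analysis.Analysis" "Jordan_Normal_Form.Matrix"
begin

no_notation vec_nth (infixl \<open>$\<close> 90)

text \<open>Since \<^term>\<open>n\<close> varies inside the statement, matrices and vectors are those of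
  Jordan_Normal_Form, with dimensions as terms. Their indices start at 0.\<close>

definition tridiag :: "nat \<Rightarrow> complex \<Rightarrow> complex \<Rightarrow> complex mat" where
  "tridiag n a b = mat n n (\<lambda>(i, j).
     if i = j then b else if i = Suc j \<or> j = Suc i then a else 0)"

text \<open>The exponential series of a square matrix. Convergence in \<open>\<complex>\<^sup>n\<^sup>\<times>\<^sup>n\<close> is entrywise
  convergence; every entry converges, see \<open>summable_mat_exp\<close> below.\<close>

definition mat_exp :: "complex mat \<Rightarrow> complex mat" where
  "mat_exp A = mat (dim_row A) (dim_row A) (\<lambda>(i, j). \<Sum>k. (A ^\<^sub>m k) $$ (i, j) / fact k)"

text \<open>Maximum absolute row sum, meaningful for matrices with at least one row.\<close>

definition mat_norm_inf :: "complex mat \<Rightarrow> real" where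
  "mat_norm_inf A = (MAX i\<in>{..<dim_row A}. \<Sum>j<dim_col A. norm (A $$ (i, j)))"

definition bessel_I :: "nat \<Rightarrow> complex \<Rightarrow> complex" where
  "bessel_I k x = (\<Sum>s. 1 / (fact s * fact (k + s)) * (x / 2) ^ (k + 2 * s))"

definition toeplitz :: "complex vec \<Rightarrow> complex mat" where
  "toeplitz u = mat (dim_vec u) (dim_vec u) (\<lambda>(i, j). if j \<le> i then u $ (i - j) else u $ (j - i))"

text \<open>With 1-based indices the \<open>(i, j)\<close> entry is \<open>v\<^sub>i\<^sub>+\<^sub>j\<^sub>-\<^sub>1\<close> if \<open>i + j \<le> n + 1\<close> and
  \<open>v\<^sub>2\<^sub>n\<^sub>+\<^sub>1\<^sub>-\<^sub>i\<^sub>-\<^sub>j\<close> otherwise; the indices below are shifted accordingly.\<close>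

definition hankel :: "complex vec \<Rightarrow> complex mat" where
  "hankel v = (let n = dim_vec v in
     mat n n (\<lambda>(i, j). if i + j < n then v $ (i + j) else v $ (2 * n - 2 - (i + j))))"

text \<open>\<open>Psi_tridiag n a b\<close> is \<open>\<Psi>(T)\<close> for \<open>T = tridiag n a b\<close>; it is a function of the parameters
  because \<open>a\<close> cannot be recovered from \<open>T\<close> when \<open>n = 1\<close>.\<close>

definition Psi_tridiag :: "nat \<Rightarrow> complex \<Rightarrow> complex \<Rightarrow> complex mat" where
  "Psi_tridiag n a b =
     toeplitz (vec n (\<lambda>k. exp b * bessel_I k (2 * a))) -
     hankel (vec n (\<lambda>k. exp b * bessel_I (k + 2) (2 * a)))"

definition Er_tridiag :: "nat \<Rightarrow> complex \<Rightarrow> complex \<Rightarrow> complex mat" where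
  "Er_tridiag n a b = mat_exp (tridiag n a b) - Psi_tridiag n a b"

lemma summable_mat_exp:
  fixes A :: "complex mat"
  assumes A: "A \<in> carrier_mat n n" and "i < n" "j < n"
  shows "summable (\<lambda>k. (A ^\<^sub>m k) $$ (i, j) / fact k)"
proof -
  define M where "M = (\<Sum>i<n. \<Sum>j<n. norm (A $$ (i, j)))"
  have M0: "0 \<le> M" unfolding M_def by (intro sum_nonneg) auto
  have MA: "norm (A $$ (i, j)) \<le> M" if "i < n" "j < n" for i j
  proof -
    have "norm (A $$ (i, j)) \<le> (\<Sum>j<n. norm (A $$ (i, j)))"
      using that by (intro member_le_sum) auto
    also have "\<dots> \<le> M"
      unfolding M_def using that
      by (intro member_le_sum[where f = "\<lambda>i. \<Sum>j<n. norm (A $$ (i, j))"] sum_nonneg) auto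
    finally show ?thesis .
  qed
  have pow: "norm ((A ^\<^sub>m k) $$ (i, j)) \<le> (n * M) ^ k" if "i < n" "j < n" for k i j
    using that
  proof (induction k arbitrary: i j)
    case 0
    then show ?case using A by auto
  next
    case (Suc k)
    have "(A ^\<^sub>m Suc k) $$ (i, j) = (\<Sum>l<n. (A ^\<^sub>m k) $$ (i, l) * A $$ (l, j))"
      using A Suc.prems by (auto simp: scalar_prod_def atLeast0LessThan intro!: sum.cong)
    also have "norm \<dots> \<le> (\<Sum>l<n. (n * M) ^ k * M)"
      using Suc MA M0 by (intro sum_norm_le) (auto simp: norm_mult intro!: mult_mono)
    also have "\<dots> = (n * M) ^ Suc k" by (simp add: algebra_simps)
    finally show ?case .
  qed
  have "summable (\<lambda>k. (n * M) ^ k / fact k)"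
    using summable_exp[of "n * M"] by (simp add: field_simps)
  then show ?thesis
    by (rule summable_comparison_test')
       (use pow assms in \<open>auto simp: norm_divide intro!: divide_right_mono\<close>)
qed

lemma summable_bessel_I:
  "summable (\<lambda>s. 1 / (fact s * fact (k + s)) * (x / 2) ^ (k + 2 * s) :: complex)"
proof -
  have "summable (\<lambda>s. norm (x / 2) ^ k * (inverse (fact s) * (norm (x / 2) ^ 2) ^ s))"
    by (intro summable_mult summable_exp)
  then show ?thesis
  proof (rule summable_comparison_test')
    fix s :: nat
    have "1 / (fact s * fact (k + s) :: real) \<le> 1 / (fact s * 1)"
      by (intro divide_left_mono mult_left_mono) (auto simp: fact_ge_1)
    then have "1 / (fact s * fact (k + s)) * norm (x / 2) ^ (k + 2 * s)
        \<le> 1 / (fact s * 1) * norm (x / 2) ^ (k + 2 * s)"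
      by (rule mult_right_mono) auto
    also have "\<dots> = norm (x / 2) ^ k * (inverse (fact s) * (norm (x / 2) ^ 2) ^ s)"
      unfolding power_add power_mult by (simp only: divide_inverse mult_1_left mult_1_right ac_simps)
    finally show "norm (1 / (fact s * fact (k + s)) * (x / 2) ^ (k + 2 * s))
        \<le> norm (x / 2) ^ k * (inverse (fact s) * (norm (x / 2) ^ 2) ^ s)"
      by (simp only: norm_mult norm_divide norm_power norm_one norm_fact)
  qed
qed

end

theory Submission
  imports Defs
begin

text \<open>Up to the factor \<open>exp b\<close> and the weights \<open>a\<^sup>k / k!\<close>, the entries of \<open>exp T\<close> count walks
  confined to \<open>{1..n}\<close>, while \<open>I\<^sub>d(2a)\<close> counts free walks on the integers with
  displacement \<open>d\<close>. With \<open>N = n + 1\<close>, the reflection principle at the walls \<open>0\<close> and \<open>N\<close> shows that the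
  walks from \<open>p\<close> to \<open>x\<close> confined to \<open>{1..n}\<close> number at most
  \<open>f(p - x) - f(p + x)\<close> and \<open>f(p - x) - f(2N - p - x)\<close>, and at least
  \<open>f(p - x) - f(p + x) - f(2N - p - x)\<close>, where \<open>f\<close> counts free walks.
  Since \<open>\<Psi>(T)\<close> keeps the nearer of the two reflected terms, an entry of the error is bounded by
  \<open>exp (Re b) I\<^sub>d(2|a|)\<close> with \<open>d = max (p + x) (2N - p - x) \<ge> N\<close>. Along a row each value of \<open>d\<close>
  occurs at most twice and these bounds decay geometrically with ratio \<open>|a| / (N + 1)\<close>, so the
  row sum is asymptotically at most \<open>2 exp (Re b) |a|\<^sup>N / N!\<close>, and \<open>N! \<ge> (N / e)\<^sup>N\<close>.\<close>

section \<open>Free and confined walks, and the reflection bounds\<close>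

primrec free_walks :: "nat \<Rightarrow> int \<Rightarrow> int" where
  "free_walks 0 x = (if x = 0 then 1 else 0)"
| "free_walks (Suc k) x = free_walks k (x - 1) + free_walks k (x + 1)"

text \<open>Walks from \<open>p\<close> to \<open>x\<close> with all positions strictly between \<open>0\<close> and \<open>N\<close>; the start \<open>p\<close>
  itself is not checked, so this reading requires \<open>0 < p < N\<close>.\<close>

primrec confined_walks :: "int \<Rightarrow> int \<Rightarrow> nat \<Rightarrow> int \<Rightarrow> int" where
  "confined_walks N p 0 x = (if x = p then 1 else 0)"
| "confined_walks N p (Suc k) x =
     (if 0 < x \<and> x < N then confined_walks N p k (x - 1) + confined_walks N p k (x + 1) else 0)"

lemma free_walks_nonneg: "0 \<le> free_walks k x"
  by (induction k arbitrary: x) auto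

lemma free_walks_minus: "free_walks k (- x) = free_walks k x"
proof (induction k arbitrary: x)
  case (Suc k)
  have "- x - 1 = - (x + 1)" "- x + 1 = - (x - 1)" by simp_all
  then show ?case by (simp only: free_walks.simps Suc add.commute)
qed simp

lemma free_walks_abs: "free_walks k \<bar>x\<bar> = free_walks k x"
  by (simp add: abs_if free_walks_minus)

lemma free_walks_commute: "free_walks k (x - y) = free_walks k (y - x)"
  using free_walks_minus[of k "x - y"] by simp

lemma free_walks_eq_0: "int k < \<bar>x\<bar> \<Longrightarrow> free_walks k x = 0"
  by (induction k arbitrary: x) auto

lemma free_walks_eq_0_parity: "odd (int k - x) \<Longrightarrow> free_walks k x = 0"
  by (induction k arbitrary: x) auto

text \<open>A walk with \<open>m\<close> steps up and \<open>k - m\<close> down has displacement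
  \<open>2 * m - k\<close>; the recursion is Pascal's rule.\<close>

lemma free_walks_choose: "free_walks k (2 * int m - int k) = int (k choose m)"
proof (induction k arbitrary: m)
  case 0
  then show ?case by (cases m) auto
next
  case (Suc k)
  show ?case
  proof (cases m)
    case 0
    then show ?thesis using Suc[of 0] free_walks_eq_0[of k "- int k - 2"]
      by (simp add: algebra_simps)
  next
    case (Suc m')
    have "free_walks k (2 * int m - int (Suc k) - 1) = int (k choose m')"
      using Suc.IH[of m'] Suc by (simp add: algebra_simps)
    moreover have "free_walks k (2 * int m - int (Suc k) + 1) = int (k choose m)"
      using Suc.IH[of m] by (simp add: algebra_simps)
    ultimately show ?thesis using Suc by simp
  qed
qed

text \<open>The difference of the two sides obeys the walk recursion in \<open>x\<close>, vanishes
  at \<open>x = 0\<close> and starts nonnegative, so it stays nonnegative on the half line.\<close>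

lemma free_walks_half_line:
  assumes "0 < p" "0 \<le> x"
  shows "free_walks k (p + x) \<le> free_walks k (p - x)"
  using assms(2)
proof (induction k arbitrary: x)
  case 0
  then show ?case using assms(1) by auto
next
  case (Suc k)
  show ?case
  proof (cases "x = 0")
    case False
    then show ?thesis using Suc.IH[of "x - 1"] Suc.IH[of "x + 1"] Suc.prems
      by (simp add: algebra_simps)
  qed simp
qed

lemma confined_walks_nonneg: "0 \<le> confined_walks N p k x"
  by (induction k arbitrary: x) auto

lemma confined_walks_boundary:
  assumes "0 < p" "p < N" "x \<le> 0 \<or> N \<le> x"
  shows "confined_walks N p k x = 0"
  using assms by (cases k) auto

text \<open>Comparison principle: both sides obey the same recursion strictly between the walls and
  agree for \<open>k = 0\<close>, while on the walls the left side is 0 and the right side is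
  nonnegative.\<close>

lemma confined_walks_le_left:
  assumes "0 < p" "p < N" "0 \<le> x" "x \<le> N"
  shows "confined_walks N p k x \<le> free_walks k (p - x) - free_walks k (p + x)"
  using assms(3,4)
proof (induction k arbitrary: x)
  case 0
  then show ?case using assms(1,2) by auto
next
  case (Suc k)
  show ?case
  proof (cases "0 < x \<and> x < N")
    case True
    then show ?thesis using Suc.IH[of "x - 1"] Suc.IH[of "x + 1"]
      by (simp add: algebra_simps)
  next
    case False
    then show ?thesis using free_walks_half_line[OF assms(1) Suc.prems(1), of "Suc k"]
      by (subst confined_walks_boundary) (use assms in auto)
  qed
qed

lemma confined_walks_reflect:
  "confined_walks N (N - p) k (N - x) = confined_walks N p k x"
proof (induction k arbitrary: x)
  case (Suc k)
  then show ?case using Suc[of "x - 1"] Suc[of "x + 1"] by (simp add: algebra_simps)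
qed simp

text \<open>The mirror map \<open>x\<close> to \<open>N - x\<close> exchanges the walls and turns
  \<open>p + x\<close> into \<open>2 * N - p - x\<close>.\<close>

lemma confined_walks_le_right:
  assumes "0 < p" "p < N" "0 \<le> x" "x \<le> N"
  shows "confined_walks N p k x \<le> free_walks k (p - x) - free_walks k (2 * N - p - x)"
  using confined_walks_le_left[of "N - p" N "N - x" k] assms
  by (simp add: confined_walks_reflect free_walks_commute[of k x p] algebra_simps)

text \<open>The same comparison in the other direction: on each wall one reflected term cancels
  \<open>free_walks k (p - x)\<close> and the other leaves a nonpositive value.\<close>

lemma confined_walks_ge:
  assumes "0 < p" "p < N" "0 \<le> x" "x \<le> N"
  shows "free_walks k (p - x) - free_walks k (p + x) - free_walks k (2 * N - p - x)
    \<le> confined_walks N p k x"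
  using assms(3,4)
proof (induction k arbitrary: x)
  case 0
  then show ?case using assms(1,2) by auto
next
  case (Suc k)
  consider "0 < x \<and> x < N" | "x = 0" | "x = N" using Suc.prems by linarith
  then show ?case
  proof cases
    case 1
    then show ?thesis using Suc.IH[of "x - 1"] Suc.IH[of "x + 1"]
      by (simp add: algebra_simps)
  next
    case 2
    then show ?thesis using free_walks_nonneg[of "Suc k" "2 * N - p"]
      by (subst confined_walks_boundary) (use assms in auto)
  next
    case 3
    then show ?thesis
      using free_walks_nonneg[of "Suc k" "N + p"] free_walks_commute[of "Suc k" p N]
      by (subst confined_walks_boundary) (use assms in \<open>auto simp: algebra_simps\<close>)
  qed
qed

text \<open>The upper bound for the nearer wall makes the quantity at most 0; the lower bound makes
  it at least minus the farther reflected term.\<close>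

lemma confined_walks_error:
  assumes "0 < p" "p < N" "0 \<le> x" "x \<le> N"
  shows "\<bar>confined_walks N p k x - free_walks k (p - x) + free_walks k (min (p + x) (2 * N - p - x))\<bar>
    \<le> free_walks k (max (p + x) (2 * N - p - x))"
proof (cases "p + x \<le> 2 * N - p - x")
  case True
  then have "min (p + x) (2 * N - p - x) = p + x" "max (p + x) (2 * N - p - x) = 2 * N - p - x"
    by (auto simp: min_def max_def)
  then show ?thesis
    using confined_walks_le_left[OF assms, of k] confined_walks_ge[OF assms, of k]
      free_walks_nonneg[of k "2 * N - p - x"] by (simp add: abs_le_iff)
next
  case False
  then have "min (p + x) (2 * N - p - x) = 2 * N - p - x" "max (p + x) (2 * N - p - x) = p + x"
    by (auto simp: min_def max_def)
  then show ?thesis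
    using confined_walks_le_right[OF assms, of k] confined_walks_ge[OF assms, of k]
      free_walks_nonneg[of k "p + x"] by (simp add: abs_le_iff)
qed

section \<open>Exponential generating functions of free walks and Bessel functions\<close>

text \<open>Displacement \<open>d\<close> is reached only after \<open>d + 2 * s\<close> steps, in
  \<open>(d + 2 * s) choose (d + s)\<close> ways; dividing by \<open>fact (d + 2 * s)\<close> leaves
  the Bessel coefficient. The field is generic because the series is used at the complex
  \<open>a\<close> and at the real \<open>norm a\<close>.\<close>

lemma free_walks_exp_series:
  fixes z c :: "'a :: {real_normed_field, banach}"
  shows "(\<lambda>k. z ^ k / fact k * of_int (free_walks k (int d))) sums c \<longleftrightarrow>
    (\<lambda>s. 1 / (fact s * fact (d + s)) * z ^ (d + 2 * s)) sums c"
proof -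
  let ?f = "\<lambda>k. z ^ k / fact k * of_int (free_walks k (int d))"
  have mono: "strict_mono (\<lambda>s. d + 2 * s)"
    by (auto simp: strict_mono_def)
  have zero: "?f k = 0" if "k \<notin> range (\<lambda>s. d + 2 * s)" for k
  proof (cases "k < d")
    case True
    then show ?thesis by (simp add: free_walks_eq_0)
  next
    case False
    have "odd (k - d)"
    proof
      assume "even (k - d)"
      then obtain s where "k - d = 2 * s" by (elim evenE)
      with False have "k = d + 2 * s" by simp
      with that show False by blast
    qed
    with False have "odd (int k - int d)" by (simp add: even_diff_nat flip: of_nat_diff)
    then show ?thesis by (simp add: free_walks_eq_0_parity)
  qed
  have eq: "?f (d + 2 * s) = 1 / (fact s * fact (d + s)) * z ^ (d + 2 * s)" for s
  proof -
    have "free_walks (d + 2 * s) (int d) = int ((d + 2 * s) choose (d + s))"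
      using free_walks_choose[of "d + 2 * s" "d + s"] by simp
    then have "?f (d + 2 * s) = z ^ (d + 2 * s) / fact (d + 2 * s) * of_nat ((d + 2 * s) choose (d + s))"
      by simp
    also have "\<dots> = 1 / (fact s * fact (d + s)) * z ^ (d + 2 * s)"
      by (subst binomial_fact) (auto simp: field_simps)
    finally show ?thesis .
  qed
  show ?thesis
    using sums_mono_reindex[OF mono, of ?f c, OF zero] eq by simp
qed

lemma free_walks_sums_bessel_I:
  "(\<lambda>k. a ^ k / fact k * of_int (free_walks k x)) sums bessel_I (nat \<bar>x\<bar>) (2 * a)"
proof -
  have "(\<lambda>s. 1 / (fact s * fact (nat \<bar>x\<bar> + s)) * a ^ (nat \<bar>x\<bar> + 2 * s)) sums bessel_I (nat \<bar>x\<bar>) (2 * a)"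
    using summable_sums[OF summable_bessel_I[of "nat \<bar>x\<bar>" "2 * a"]]
    by (simp add: bessel_I_def)
  then show ?thesis
    by (subst (asm) free_walks_exp_series[symmetric]) (simp add: free_walks_abs)
qed

text \<open>Each of the \<open>s\<close> further factors of \<open>fact (d + s)\<close> is at least
  \<open>d + 1\<close>.\<close>

lemma fact_mult_power_le: "fact d * (d + 1) ^ s \<le> (fact (d + s) :: nat)"
proof (induction s)
  case (Suc s)
  have "fact d * (d + 1) ^ Suc s = (d + 1) * (fact d * (d + 1) ^ s)"
    by (simp only: power_Suc mult_ac)
  also have "\<dots> \<le> (d + Suc s) * fact (d + s)" using Suc by (intro mult_mono) auto
  finally show ?case by simp
qed simp

lemma fact_mult_power_le_real: "fact d * (real d + 1) ^ s \<le> fact (d + s)"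
proof -
  have "real (fact d * (d + 1) ^ s) \<le> real (fact (d + s))"
    using fact_mult_power_le by (simp only: of_nat_le_iff)
  then show ?thesis by (simp add: add.commute)
qed

text \<open>Replacing \<open>fact (d + s)\<close> by \<open>fact d * (d + 1) ^ s\<close> leaves the
  exponential series at \<open>r\<^sup>2 / (d + 1)\<close>.\<close>

lemma free_walks_series_bound:
  fixes r :: real
  assumes r: "0 \<le> r"
  shows "summable (\<lambda>k. r ^ k / fact k * of_int (free_walks k (int d)))" (is ?A)
    and "(\<Sum>k. r ^ k / fact k * of_int (free_walks k (int d))) \<le> r ^ d / fact d * exp (r\<^sup>2 / (d + 1))" (is ?B)
proof -
  let ?g = "\<lambda>s. 1 / (fact s * fact (d + s)) * r ^ (d + 2 * s)"
  have le: "?g s \<le> r ^ d / fact d * ((r\<^sup>2 / (d + 1)) ^ s / fact s)" for s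
  proof -
    have "?g s \<le> 1 / (fact s * (fact d * (real d + 1) ^ s)) * r ^ (d + 2 * s)"
      using r fact_mult_power_le_real[of d s]
      by (intro mult_right_mono divide_left_mono mult_left_mono) auto
    also have "\<dots> = r ^ d / fact d * ((r\<^sup>2 / (d + 1)) ^ s / fact s)"
      by (simp add: power_add power_mult power_divide add.commute)
    finally show ?thesis .
  qed
  have exp: "(\<lambda>s. r ^ d / fact d * ((r\<^sup>2 / (d + 1)) ^ s / fact s)) sums (r ^ d / fact d * exp (r\<^sup>2 / (d + 1)))"
    using exp_converges[of "r\<^sup>2 / (d + 1)"] by (intro sums_mult) (simp add: field_simps)
  have "summable ?g"
    by (rule summable_comparison_test'[OF sums_summable[OF exp]])
       (use r le in \<open>auto simp: abs_mult\<close>)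
  then have g: "(\<lambda>k. r ^ k / fact k * of_int (free_walks k (int d))) sums suminf ?g"
    by (subst free_walks_exp_series) (rule summable_sums)
  then show ?A by (rule sums_summable)
  have "suminf ?g \<le> r ^ d / fact d * exp (r\<^sup>2 / (d + 1))"
    using suminf_le[OF le \<open>summable ?g\<close> sums_summable[OF exp]] sums_unique[OF exp] by simp
  then show ?B using sums_unique[OF g] by simp
qed

section \<open>Powers and exponential of the tridiagonal matrix\<close>

lemma tridiag_carrier [simp]: "tridiag n a b \<in> carrier_mat n n"
  by (simp add: tridiag_def)

text \<open>Index \<open>m\<close> stands for position \<open>m + 1\<close>. As \<open>G\<close>
  vanishes at the walls \<open>0\<close> and \<open>n + 1\<close>, the first and last columns obey
  the same three-term formula as the others.\<close>

lemma sum_tridiag: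
  assumes j: "j < n" and G: "G 0 = 0" "G (int n + 1) = 0"
  shows "(\<Sum>m<n. G (int m + 1) * tridiag n a b $$ (m, j)) =
    b * G (int j + 1) + a * (G (int j) + G (int j + 2))"
proof -
  have "(\<Sum>m<n. G (int m + 1) * tridiag n a b $$ (m, j)) =
    (\<Sum>m<n. (if m = j then b * G (int m + 1) else 0) +
       ((if m = Suc j then a * G (int m + 1) else 0) + (if Suc m = j then a * G (int m + 1) else 0)))"
    using j by (intro sum.cong) (auto simp: tridiag_def)
  also have "\<dots> = b * G (int j + 1) + ((if Suc j < n then a * G (int j + 2) else 0) +
      (\<Sum>m<n. if Suc m = j then a * G (int m + 1) else 0))"
    using j by (simp add: sum.distrib add.commute)
  also have "(\<Sum>m<n. if Suc m = j then a * G (int m + 1) else 0) = a * G (int j)"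
    using j G by (cases j) (auto simp: add.commute)
  also have "(if Suc j < n then a * G (int j + 2) else 0) = a * G (int j + 2)"
  proof (cases "Suc j < n")
    case False
    with j have eq: "int j + 2 = int n + 1" by simp
    show ?thesis using False G unfolding eq by simp
  qed simp
  finally show ?thesis by (simp add: algebra_simps)
qed

text \<open>This is the binomial theorem for \<open>b\<close> times the identity plus
  \<open>a\<close> times the adjacency matrix of a path, whose \<open>l\<close>-th power counts
  confined walks.\<close>

lemma tridiag_power:
  assumes "i < n" "j < n"
  shows "(tridiag n a b ^\<^sub>m k) $$ (i, j) =
    (\<Sum>l\<le>k. of_nat (k choose l) * b ^ (k - l) * a ^ l *
       of_int (confined_walks (int n + 1) (int i + 1) l (int j + 1)))"
  using assms(2)
proof (induction k arbitrary: j)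
  case 0
  then show ?case using assms(1) by (auto simp: tridiag_def)
next
  case (Suc k)
  define w where "w l x = (of_int (confined_walks (int n + 1) (int i + 1) l x) :: complex)" for l x
  define F where "F k x = (\<Sum>l\<le>k. of_nat (k choose l) * b ^ (k - l) * a ^ l * w l x)" for k x
  have bd: "F k 0 = 0" "F k (int n + 1) = 0" for k
    using assms(1) by (simp_all add: F_def w_def confined_walks_boundary)
  have wS: "w (Suc l) (int j + 1) = w l (int j) + w l (int j + 2)" for l
    using Suc.prems by (simp add: w_def add.assoc)
  have "(tridiag n a b ^\<^sub>m Suc k) $$ (i, j) =
      (\<Sum>m<n. (tridiag n a b ^\<^sub>m k) $$ (i, m) * tridiag n a b $$ (m, j))"
    using assms(1) Suc.prems
    by (simp add: scalar_prod_def atLeast0LessThan pow_carrier_mat[OF tridiag_carrier, THEN carrier_matD(1)]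
       pow_carrier_mat[OF tridiag_carrier, THEN carrier_matD(2)] carrier_matD[OF tridiag_carrier])
  also have "\<dots> = (\<Sum>m<n. F k (int m + 1) * tridiag n a b $$ (m, j))"
    using Suc.IH by (intro sum.cong) (auto simp: F_def w_def)
  also have "\<dots> = b * F k (int j + 1) + a * (F k (int j) + F k (int j + 2))"
    by (rule sum_tridiag[OF Suc.prems bd])
  also have "a * (F k (int j) + F k (int j + 2)) =
      (\<Sum>l\<le>k. of_nat (k choose l) * b ^ (k - l) * a ^ Suc l * w (Suc l) (int j + 1))"
    by (simp only: F_def wS sum_distrib_left power_Suc distrib_left sum.distrib mult_ac)
  also have "b * F k (int j + 1) =
      b ^ Suc k * w 0 (int j + 1) +
      (\<Sum>l\<le>k. of_nat (k choose Suc l) * b ^ (k - l) * a ^ Suc l * w (Suc l) (int j + 1))"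
  proof -
    \<comment> \<open>The extra summand \<open>l = Suc k\<close> is zero because
      \<open>k choose Suc k\<close> is.\<close>
    have "b * F k (int j + 1) =
        (\<Sum>l\<le>Suc k. of_nat (k choose l) * b ^ (Suc k - l) * a ^ l * w l (int j + 1))"
      by (simp add: F_def sum_distrib_left Suc_diff_le algebra_simps)
    also have "\<dots> = b ^ Suc k * w 0 (int j + 1) +
      (\<Sum>l\<le>k. of_nat (k choose Suc l) * b ^ (k - l) * a ^ Suc l * w (Suc l) (int j + 1))"
      by (subst sum.atMost_Suc_shift) simp
    finally show ?thesis .
  qed
  \<comment> \<open>Pascal's rule merges the two sums.\<close>
  also have "b ^ Suc k * w 0 (int j + 1) +
      (\<Sum>l\<le>k. of_nat (k choose Suc l) * b ^ (k - l) * a ^ Suc l * w (Suc l) (int j + 1)) +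
      (\<Sum>l\<le>k. of_nat (k choose l) * b ^ (k - l) * a ^ Suc l * w (Suc l) (int j + 1)) =
      F (Suc k) (int j + 1)"
    unfolding F_def by (subst sum.atMost_Suc_shift) (simp add: sum.distrib algebra_simps)
  finally show ?case by (simp add: F_def w_def)
qed

text \<open>Divided by \<open>fact k\<close>, the binomial sum for the \<open>k\<close>-th power is
  a Cauchy product of the walk series with the series of \<open>exp b\<close>.\<close>

lemma mat_exp_tridiag:
  assumes "i < n" "j < n"
  defines "w \<equiv> \<lambda>l. confined_walks (int n + 1) (int i + 1) l (int j + 1)"
  shows "summable (\<lambda>l. a ^ l / fact l * of_int (w l))" (is ?A)
    and "mat_exp (tridiag n a b) $$ (i, j) = exp b * (\<Sum>l. a ^ l / fact l * of_int (w l))" (is ?B)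
proof -
  let ?f = "\<lambda>l. a ^ l / fact l * of_int (w l)" and ?g = "\<lambda>m. b ^ m / fact m"
  have w: "w l \<le> free_walks l (int (nat \<bar>int i - int j\<bar>))" for l
    using confined_walks_le_left[of "int i + 1" "int n + 1" "int j + 1" l] assms(1,2)
      free_walks_nonneg[of l "int i + 1 + (int j + 1)"] by (simp add: w_def free_walks_abs)
  have w0: "0 \<le> w l" for l by (simp add: w_def confined_walks_nonneg)
  \<comment> \<open>The Cauchy product needs absolute convergence; free walks with the same
    displacement dominate.\<close>
  have nA: "summable (\<lambda>l. norm (?f l))"
  proof (rule summable_comparison_test')
    show "summable (\<lambda>k. norm a ^ k / fact k * of_int (free_walks k (int (nat \<bar>int i - int j\<bar>))))"
      by (rule free_walks_series_bound) simp
    show "norm (norm (?f l)) \<le> norm a ^ l / fact l * of_int (free_walks l (int (nat \<bar>int i - int j\<bar>)))" for l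
    proof -
      have "\<bar>real_of_int (w l)\<bar> \<le> of_int (free_walks l (int (nat \<bar>int i - int j\<bar>)))"
        using w[of l] w0[of l] by linarith
      then show ?thesis
        by (simp add: norm_mult norm_divide norm_power mult_left_mono divide_right_mono del: int_nat_eq)
    qed
  qed
  then show ?A by (rule summable_norm_cancel)
  have nB: "summable (\<lambda>m. norm (?g m))"
    using summable_norm_exp[of b] by (simp add: norm_divide norm_power field_simps)
  have B: "suminf ?g = exp b"
    by (simp add: exp_def scaleR_conv_of_real divide_inverse mult.commute)
  have "(tridiag n a b ^\<^sub>m k) $$ (i, j) / fact k = (\<Sum>l\<le>k. ?f l * ?g (k - l))" for k
  proof -
    have "(tridiag n a b ^\<^sub>m k) $$ (i, j) / fact k =
       (\<Sum>l\<le>k. of_nat (k choose l) * b ^ (k - l) * a ^ l * of_int (w l) / fact k)"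
      by (simp add: tridiag_power[OF assms(1,2)] w_def sum_divide_distrib)
    also have "\<dots> = (\<Sum>l\<le>k. ?f l * ?g (k - l))"
      by (intro sum.cong) (auto simp: binomial_fact field_simps)
    finally show ?thesis .
  qed
  then show ?B
    using Cauchy_product[OF nA nB] assms(1,2) B carrier_matD[OF tridiag_carrier, of n a b]
    by (simp add: mat_exp_def mult.commute)
qed

section \<open>Entrywise error bound\<close>

text \<open>With \<open>p = i + 1\<close>, \<open>x = j + 1\<close> and \<open>N = n + 1\<close>,
  the two arguments of \<open>min\<close> are \<open>p + x\<close> and \<open>2 * N - p - x\<close>,
  so the Hankel part is the nearer reflection.\<close>

lemma Psi_tridiag_entry:
  assumes "i < n" "j < n"
  shows "Psi_tridiag n a b $$ (i, j) = exp b *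
    (bessel_I (nat \<bar>int i - int j\<bar>) (2 * a) - bessel_I (min (i + j + 2) (2 * n - (i + j))) (2 * a))"
proof -
  have "nat \<bar>int i - int j\<bar> = (if j \<le> i then i - j else j - i)" by auto
  moreover have "min (i + j + 2) (2 * n - (i + j)) = (if i + j < n then i + j else 2 * n - 2 - (i + j)) + 2"
    using assms by (auto simp: min_def)
  ultimately show ?thesis
    using assms by (simp add: Psi_tridiag_def toeplitz_def hankel_def Let_def algebra_simps)
qed

lemma norm_Er_tridiag_le:
  assumes "i < n" "j < n"
  defines "d \<equiv> max (i + j + 2) (2 * n - (i + j))"
  shows "norm (Er_tridiag n a b $$ (i, j)) \<le>
    exp (Re b) * (norm a ^ d / fact d * exp ((norm a)\<^sup>2 / (d + 1)))"
proof -
  define w where "w l = confined_walks (int n + 1) (int i + 1) l (int j + 1)" for l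
  define m where "m = min (i + j + 2) (2 * n - (i + j))"
  \<comment> \<open>Once \<open>exp b\<close> is factored out, \<open>c l\<close> is the integer
    coefficient of \<open>a ^ l / fact l\<close> in the error.\<close>
  define c where "c l = w l - free_walks l (int i - int j) + free_walks l (int m)" for l
  have c: "\<bar>c l\<bar> \<le> free_walks l (int d)" for l
  proof -
    have "int m = min (int i + 1 + (int j + 1)) (2 * (int n + 1) - (int i + 1) - (int j + 1))"
      "int d = max (int i + 1 + (int j + 1)) (2 * (int n + 1) - (int i + 1) - (int j + 1))"
      using assms(1,2) by (auto simp: m_def d_def)
    then show ?thesis
      using confined_walks_error[of "int i + 1" "int n + 1" "int j + 1" l] assms(1,2)
      by (simp add: c_def w_def)
  qed
  note summ = free_walks_series_bound[OF norm_ge_zero[of a], of d]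
  have "(\<lambda>l. a ^ l / fact l * of_int (w l) - a ^ l / fact l * of_int (free_walks l (int i - int j))
      + a ^ l / fact l * of_int (free_walks l (int m))) sums
    ((\<Sum>l. a ^ l / fact l * of_int (w l)) - bessel_I (nat \<bar>int i - int j\<bar>) (2 * a)
      + bessel_I (nat \<bar>int m\<bar>) (2 * a))"
    unfolding w_def
    by (intro sums_add sums_diff free_walks_sums_bessel_I summable_sums mat_exp_tridiag(1) assms(1,2))
  then have S: "(\<lambda>l. a ^ l / fact l * of_int (c l)) sums
    ((\<Sum>l. a ^ l / fact l * of_int (w l)) - bessel_I (nat \<bar>int i - int j\<bar>) (2 * a) + bessel_I m (2 * a))"
    by (simp add: c_def algebra_simps)
  have "Er_tridiag n a b $$ (i, j) = mat_exp (tridiag n a b) $$ (i, j) - Psi_tridiag n a b $$ (i, j)"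
    using assms(1,2) by (simp add: Er_tridiag_def Psi_tridiag_def hankel_def Let_def)
  also have "\<dots> = exp b * (\<Sum>l. a ^ l / fact l * of_int (c l))"
    unfolding mat_exp_tridiag(2)[OF assms(1,2)] Psi_tridiag_entry[OF assms(1,2)]
      sums_unique[OF S, symmetric] w_def m_def by (simp only: right_diff_distrib distrib_left diff_diff_eq2 diff_add_eq)
  finally have "norm (Er_tridiag n a b $$ (i, j)) = exp (Re b) * norm (\<Sum>l. a ^ l / fact l * of_int (c l))"
    by (simp add: norm_mult)
  also have "norm (\<Sum>l. a ^ l / fact l * of_int (c l)) \<le> (\<Sum>l. norm a ^ l / fact l * of_int (free_walks l (int d)))"
  proof (rule norm_suminf_le)
    show "norm (a ^ l / fact l * of_int (c l)) \<le> norm a ^ l / fact l * of_int (free_walks l (int d))" for l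
    proof -
      have "\<bar>real_of_int (c l)\<bar> \<le> of_int (free_walks l (int d))"
        using c[of l] by (simp only: of_int_le_iff flip: of_int_abs)
      then show ?thesis
        by (simp add: norm_mult norm_divide norm_power mult_left_mono divide_right_mono)
    qed
  qed (rule summ(1))
  also have "\<dots> \<le> norm a ^ d / fact d * exp ((norm a)\<^sup>2 / (d + 1))" by (rule summ(2))
  finally show ?thesis by simp
qed

section \<open>Row sums and asymptotics\<close>

lemma power_div_fact_le_geometric:
  fixes r :: real
  assumes "0 \<le> r" "N \<le> d"
  shows "r ^ d / fact d \<le> r ^ N / fact N * (r / (N + 1)) ^ (d - N)"
proof -
  have "r ^ d / fact d \<le> r ^ d / (fact N * (real N + 1) ^ (d - N))"
    using fact_mult_power_le_real[of N "d - N"] assms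
    by (intro divide_left_mono) auto
  also have "\<dots> = r ^ N * r ^ (d - N) / (fact N * (real N + 1) ^ (d - N))"
    using assms by (simp flip: power_add)
  finally show ?thesis by (simp add: power_divide add.commute)
qed

text \<open>Injectivity makes the exponents distinct, so the sum is part of the full geometric
  series.\<close>

lemma sum_power_le_geometric:
  fixes q :: real
  assumes "0 \<le> q" "q < 1" "finite A" "inj_on f A"
  shows "(\<Sum>j\<in>A. q ^ f j) \<le> 1 / (1 - q)"
proof -
  have "(\<Sum>j\<in>A. q ^ f j) = (\<Sum>t\<in>f ` A. q ^ t)"
    using assms(4) by (simp add: sum.reindex)
  also have "\<dots> \<le> (\<Sum>t. q ^ t)"
    using assms by (intro sum_le_suminf) (auto simp: summable_geometric)
  also have "\<dots> = 1 / (1 - q)"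
    using assms by (simp add: suminf_geometric)
  finally show ?thesis .
qed

text \<open>A single term of the exponential series; taking \<open>x = k\<close> gives the bound
  \<open>(k / e) ^ k\<close> below \<open>fact k\<close>.\<close>

lemma power_div_fact_le_exp:
  fixes x :: real
  assumes "0 \<le> x"
  shows "x ^ k / fact k \<le> exp x"
proof -
  have "(\<lambda>k. x ^ k / fact k) sums exp x"
    using exp_converges[of x] by (simp add: field_simps)
  from sum_le_suminf[OF sums_summable[OF this], of "{k}"] sums_unique[OF this] assms
  show ?thesis by simp
qed

text \<open>In the prefactor, the exponential comes from the Bessel tails and the denominator from
  the geometric decay along a row; both tend to 1. The condition on \<open>norm a\<close> makes the
  ratio less than 1.\<close>

lemma mat_norm_inf_Er_tridiag_le:
  fixes a b :: complex
  assumes "0 < n" "norm a < n + 2"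
  shows "mat_norm_inf (Er_tridiag n a b) \<le>
    exp ((norm a)\<^sup>2 / real (n + 2)) / (1 - norm a / real (n + 2)) *
      (2 * exp (Re b) * (norm a * exp 1 / real (n + 1)) ^ (n + 1))"
proof -
  define r where "r = norm a"
  define q where "q = r / (n + 2)"
  define C where "C = exp (Re b) * (r ^ (n + 1) / fact (n + 1) * exp (r\<^sup>2 / (n + 2)))"
  have r: "0 \<le> r" and q: "0 \<le> q" "q < 1"
    using assms by (auto simp: r_def q_def)
  have C: "0 \<le> C" using r by (simp add: C_def)
  have entry: "norm (Er_tridiag n a b $$ (i, j)) \<le> C * q ^ (max (i + j + 2) (2 * n - (i + j)) - (n + 1))"
    if "i < n" "j < n" for i j
  proof -
    define d where "d = max (i + j + 2) (2 * n - (i + j))"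
    have d: "n + 1 \<le> d" using that by (auto simp: d_def)
    have "norm (Er_tridiag n a b $$ (i, j)) \<le> exp (Re b) * (r ^ d / fact d * exp (r\<^sup>2 / (d + 1)))"
      using norm_Er_tridiag_le[OF that] by (simp add: r_def d_def)
    also have "\<dots> \<le> exp (Re b) * ((r ^ (n + 1) / fact (n + 1) * q ^ (d - (n + 1))) * exp (r\<^sup>2 / (n + 2)))"
    proof (intro mult_left_mono mult_mono)
      show "r ^ d / fact d \<le> r ^ (n + 1) / fact (n + 1) * q ^ (d - (n + 1))"
        using power_div_fact_le_geometric[OF r d] by (simp add: q_def add_ac)
      show "exp (r\<^sup>2 / (d + 1)) \<le> exp (r\<^sup>2 / (n + 2))"
        using d by (simp add: divide_left_mono)
    qed (use r q in auto)
    finally show ?thesis by (simp add: C_def d_def mult_ac)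
  qed
  have row: "(\<Sum>j<n. norm (Er_tridiag n a b $$ (i, j))) \<le> C * (2 / (1 - q))" if i: "i < n" for i
  proof -
    have "(\<Sum>j<n. norm (Er_tridiag n a b $$ (i, j))) \<le>
        (\<Sum>j<n. C * q ^ (max (i + j + 2) (2 * n - (i + j)) - (n + 1)))"
      using entry[OF i] by (intro sum_mono) auto
    also have "\<dots> = C * (\<Sum>j<n. q ^ (max (i + j + 2) (2 * n - (i + j)) - (n + 1)))"
      by (simp add: sum_distrib_left)
    \<comment> \<open>The row is split at the antidiagonal \<open>i + j + 1 = n\<close>. On each
      side the exponents are distinct, and the two geometric sums produce the factor 2.\<close>
    also have "(\<Sum>j<n. q ^ (max (i + j + 2) (2 * n - (i + j)) - (n + 1))) =
        (\<Sum>j | j < n \<and> i + j + 1 < n. q ^ (n - 1 - (i + j))) +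
        (\<Sum>j | j < n \<and> n \<le> i + j + 1. q ^ (i + j + 1 - n))"
    proof -
      have U: "{..<n} = {j. j < n \<and> i + j + 1 < n} \<union> {j. j < n \<and> n \<le> i + j + 1}" by auto
      show ?thesis
        unfolding U by (subst sum.union_disjoint)
         (auto intro!: arg_cong2[where f = "(+)"] sum.cong arg_cong[where f = "power q"] simp: max_def)
    qed
    also have "\<dots> \<le> 1 / (1 - q) + 1 / (1 - q)"
      using q by (intro add_mono sum_power_le_geometric) (auto simp: inj_on_def)
    finally show ?thesis using C by (simp add: mult_left_mono)
  qed
  have dims: "dim_row (Er_tridiag n a b) = n" "dim_col (Er_tridiag n a b) = n"
    by (simp_all add: Er_tridiag_def Psi_tridiag_def hankel_def Let_def)
  have "mat_norm_inf (Er_tridiag n a b) \<le> C * (2 / (1 - q))"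
    unfolding mat_norm_inf_def dims using row assms(1) by (subst Max_le_iff) auto
  also have "\<dots> \<le> exp (r\<^sup>2 / (n + 2)) / (1 - q) *
      (2 * exp (Re b) * (r * exp 1 / real (n + 1)) ^ (n + 1))"
  proof -
    have "real (n + 1) ^ (n + 1) / fact (n + 1) \<le> exp 1 ^ (n + 1)"
      using power_div_fact_le_exp[of "real (n + 1)" "n + 1"] exp_of_nat_mult[of "n + 1" "1 :: real"]
      by (simp only: mult_1_right)
    then have "r ^ (n + 1) * (real (n + 1) ^ (n + 1) / fact (n + 1)) / real (n + 1) ^ (n + 1)
        \<le> r ^ (n + 1) * exp 1 ^ (n + 1) / real (n + 1) ^ (n + 1)"
      using r by (intro divide_right_mono mult_left_mono) auto
    then have "r ^ (n + 1) / fact (n + 1) \<le> (r * exp 1 / real (n + 1)) ^ (n + 1)"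
      unfolding power_divide power_mult_distrib by (simp del: power_Suc fact_Suc)
    then have "exp (r\<^sup>2 / (n + 2)) / (1 - q) * (2 * exp (Re b) * (r ^ (n + 1) / fact (n + 1))) \<le>
      exp (r\<^sup>2 / (n + 2)) / (1 - q) * (2 * exp (Re b) * (r * exp 1 / real (n + 1)) ^ (n + 1))"
      using q by (intro mult_left_mono) auto
    then show ?thesis by (simp only: C_def mult_ac times_divide_eq_left times_divide_eq_right)
  qed
  finally show ?thesis unfolding r_def q_def by (simp only: of_nat_add of_nat_numeral)
qed

theorem corollary2p3:
  fixes a b :: complex
  shows "\<exists>\<epsilon> :: nat \<Rightarrow> real. \<epsilon> \<longlonglongrightarrow> 0 \<and>
    (\<forall>\<^sub>F n in sequentially.
       mat_norm_inf (Er_tridiag n a b)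
         \<le> (1 + \<epsilon> n) * (2 * exp (Re b) * (norm a * exp 1 / real (n + 1)) ^ (n + 1)))"
proof (intro exI conjI)
  \<comment> \<open>The witness is the prefactor of the explicit norm bound, minus 1.\<close>
  let ?\<epsilon> = "\<lambda>n. exp ((norm a)\<^sup>2 / real (n + 2)) / (1 - norm a / real (n + 2)) - 1"
  have "(\<lambda>n. c / real (n + 2)) \<longlonglongrightarrow> 0" for c
    by (intro tendsto_divide_0[OF tendsto_const] filterlim_compose[OF filterlim_real_at_infinity_sequentially]
      filterlim_add_const_nat_at_top)
  note lim = this
  have "?\<epsilon> \<longlonglongrightarrow> exp 0 / (1 - 0) - 1"
    by (intro tendsto_intros lim) simp
  then show "?\<epsilon> \<longlonglongrightarrow> 0" by simp
  \<comment> \<open>For \<open>n\<close> at least \<open>Suc m\<close>, both \<open>0 < n\<close>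
    and \<open>norm a < n + 2\<close> hold, so the explicit bound applies.\<close>
  obtain m where m: "norm a < real m" using reals_Archimedean2 by blast
  show "\<forall>\<^sub>F n in sequentially. mat_norm_inf (Er_tridiag n a b)
     \<le> (1 + ?\<epsilon> n) * (2 * exp (Re b) * (norm a * exp 1 / real (n + 1)) ^ (n + 1))"
    using eventually_ge_at_top[of "Suc m"]
  proof eventually_elim
    case (elim n)
    then show ?case using mat_norm_inf_Er_tridiag_le[of n a b] m by (simp add: add.commute)
  qed
qed

end
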